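(* Let $d \ge 1$ and let $(S,T;\phi)$ be a matched pair in $\{0,1\}^d$ with $S \cap T = \emptyset$. Then there exist $|S|$ pairwise edge-disjoint directed paths in the directed $d$-dimensional hypercube, each starting at a vertex of $S$ and ending at a vertex of $T$.
   Context: The directed $d$-dimensional hypercube has vertex set $\{0,1\}^d$ and a directed edge $(x,y)$ whenever $x$ and $y$ differ in exactly one coordinate and $y$ has one more $1$ than $x$ (so directed paths are monotone). Write $x \prec y$ if $x \ne y$ and $x_i \le y_i$ for all $i$. A matched pair $(S,T;\phi)$ consists of sets $S,T \subseteq \{0,1\}^d$ and a bijection $\phi:S\to T$ with $s \prec \phi(s)$ for all $s \in S$. *)

theory Defs
  imports "Graph_Theory.Graph_Theory" "HOL-Library.FuncSet"
begin

text \<open>Vertices are extensional functions (\<^const>\<open>undefined\<close> outside \<open>{..<d}\<close>), so that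
  distinct points of the cube are distinct as functions.\<close>

definition cube :: "nat \<Rightarrow> (nat \<Rightarrow> nat) set" where
  "cube d = {..<d} \<rightarrow>\<^sub>E {0, 1}"

definition cube_edges :: "nat \<Rightarrow> ((nat \<Rightarrow> nat) \<times> (nat \<Rightarrow> nat)) set" where
  "cube_edges d = {(x, y). x \<in> cube d \<and> y \<in> cube d
     \<and> card {i. i < d \<and> x i \<noteq> y i} = 1
     \<and> card {i. i < d \<and> y i = 1} = card {i. i < d \<and> x i = 1} + 1}"

definition directed_hypercube ::
    "nat \<Rightarrow> (nat \<Rightarrow> nat, (nat \<Rightarrow> nat) \<times> (nat \<Rightarrow> nat)) pre_digraph" where
  "directed_hypercube d = \<lparr>verts = cube d, arcs = cube_edges d, tail = fst, head = snd\<rparr>"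

definition cube_less :: "nat \<Rightarrow> (nat \<Rightarrow> nat) \<Rightarrow> (nat \<Rightarrow> nat) \<Rightarrow> bool" where
  "cube_less d x y \<longleftrightarrow> x \<noteq> y \<and> (\<forall>i<d. x i \<le> y i)"

definition matched_pair ::
    "nat \<Rightarrow> (nat \<Rightarrow> nat) set \<Rightarrow> (nat \<Rightarrow> nat) set \<Rightarrow> ((nat \<Rightarrow> nat) \<Rightarrow> (nat \<Rightarrow> nat)) \<Rightarrow> bool" where
  "matched_pair d S T \<phi> \<longleftrightarrow>
     S \<subseteq> cube d \<and> T \<subseteq> cube d \<and> bij_betw \<phi> S T \<and> (\<forall>s\<in>S. cube_less d s (\<phi> s))"

lemma digraph_directed_hypercube: "digraph (directed_hypercube d)"
proof
  have fin: "finite (cube d)" by (simp add: cube_def finite_PiE)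
  show "finite (verts (directed_hypercube d))" using fin by (simp add: directed_hypercube_def)
  have "cube_edges d \<subseteq> cube d \<times> cube d" by (auto simp: cube_edges_def)
  then show "finite (arcs (directed_hypercube d))"
    using fin by (auto simp: directed_hypercube_def intro: finite_subset)
qed (auto simp: directed_hypercube_def cube_edges_def arc_to_ends_def)

end

theory Submission
  imports Defs
begin

text \<open>
  By max-flow min-cut it suffices that every vertex set \<open>U\<close> with \<open>S \<subseteq> U\<close> and \<open>U \<inter> T = {}\<close> is left by at
  least \<open>|S|\<close> edges. A monotone function must differ from the indicator \<open>f\<close> of \<open>U\<close> at one end of each
  matched pair, that is, in at least \<open>|S|\<close> points; so it is enough to find a monotone function that
  differs from \<open>f\<close> in no more points than there are edges along which \<open>f\<close> drops from 1 to 0.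

  This goes by induction on the dimension. Split \<open>f\<close> into its restrictions \<open>f0\<close>, \<open>f1\<close> to the two facets of a
  coordinate and let \<open>a0\<close>, \<open>a1\<close> be the monotone approximations obtained for them. Both \<open>(a0, a0 \<or> a1)\<close>
  and \<open>(a0 \<and> a1, a1)\<close> are monotone on the whole cube, and on average they cost at most
  the number of dropping edges between the facets on top of the errors of \<open>a0\<close> and \<open>a1\<close>.
\<close>

section \<open>Distance to monotonicity on the Boolean lattice\<close>

text \<open>A sum of \<open>of_bool\<close> rather than a cardinality: it splits over the two facets
  of a coordinate, and the errors of several functions can be compared set by set.\<close>

definition disagreement :: "'a set \<Rightarrow> ('a set \<Rightarrow> bool) \<Rightarrow> ('a set \<Rightarrow> bool) \<Rightarrow> nat" where
  "disagreement I f g = (\<Sum>X\<in>Pow I. of_bool (f X \<noteq> g X))"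

definition violated_edges :: "'a set \<Rightarrow> ('a set \<Rightarrow> bool) \<Rightarrow> ('a set \<times> 'a) set" where
  "violated_edges I f = {(X, i). X \<subseteq> I \<and> i \<in> I - X \<and> f X \<and> \<not> f (insert i X)}"

lemma finite_violated_edges: "finite I \<Longrightarrow> finite (violated_edges I f)"
  by (rule finite_subset[of _ "Pow I \<times> I"]) (auto simp: violated_edges_def)

lemma sum_Pow_insert:
  assumes "finite I" "j \<notin> I"
  shows "(\<Sum>X\<in>Pow (insert j I). h X) = (\<Sum>X\<in>Pow I. h X) + (\<Sum>X\<in>Pow I. h (insert j X))"
proof -
  have inj: "inj_on (insert j) (Pow I)" using assms(2) by (auto simp: inj_on_def)
  have "Pow I \<inter> insert j ` Pow I = {}" using assms(2) by auto
  then show ?thesis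
    unfolding Pow_insert using assms(1) by (simp add: sum.union_disjoint sum.reindex[OF inj])
qed

lemma disagreement_insert:
  assumes "finite I" "j \<notin> I"
  shows "disagreement (insert j I) f g =
    disagreement I f g + disagreement I (\<lambda>X. f (insert j X)) (\<lambda>X. g (insert j X))"
  unfolding disagreement_def by (rule sum_Pow_insert[OF assms])

lemma disagreement_cong:
  assumes "\<And>X. X \<subseteq> I \<Longrightarrow> g X = g' X"
  shows "disagreement I f g = disagreement I f g'"
  unfolding disagreement_def using assms by (auto intro!: sum.cong)

text \<open>The three terms come from the edges inside the facet without \<open>j\<close>, inside
  the facet with \<open>j\<close>, and in direction \<open>j\<close>; these kinds are
  disjoint.\<close>

lemma card_violated_edges_insert:
  assumes "finite I" "j \<notin> I"
  shows "card (violated_edges (insert j I) f) \<ge>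
    card (violated_edges I f) + card (violated_edges I (\<lambda>X. f (insert j X)))
    + card {X \<in> Pow I. f X \<and> \<not> f (insert j X)}"
proof -
  let ?V0 = "violated_edges I f" and ?V1 = "violated_edges I (\<lambda>X. f (insert j X))"
  let ?A = "{X \<in> Pow I. f X \<and> \<not> f (insert j X)}"
  let ?W1 = "(\<lambda>(X, i). (insert j X, i)) ` ?V1" and ?WA = "(\<lambda>X. (X, j)) ` ?A"
  have c1: "card ?W1 = card ?V1"
    using assms(2) by (intro card_image) (auto simp: inj_on_def violated_edges_def)
  have cA: "card ?WA = card ?A"
    by (intro card_image) (auto simp: inj_on_def)
  have fin: "finite ?V0" "finite ?W1" "finite ?WA"
    using assms(1) by (auto simp: finite_violated_edges)
  have disj: "?V0 \<inter> ?W1 = {}" "(?V0 \<union> ?W1) \<inter> ?WA = {}"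
    using assms(2) by (auto simp: violated_edges_def)
  have "card ?V0 + card ?V1 + card ?A = card (?V0 \<union> ?W1 \<union> ?WA)"
    unfolding card_Un_disjoint[OF finite_UnI[OF fin(1,2)] fin(3) disj(2)]
      card_Un_disjoint[OF fin(1,2) disj(1)] c1 cA by (rule refl)
  also have "\<dots> \<le> card (violated_edges (insert j I) f)"
  proof (rule card_mono)
    show "finite (violated_edges (insert j I) f)"
      using assms(1) by (simp add: finite_violated_edges)
    show "?V0 \<union> ?W1 \<union> ?WA \<subseteq> violated_edges (insert j I) f"
      using assms(2) by (auto simp: violated_edges_def insert_commute)
  qed
  finally show ?thesis .
qed

theorem monotone_disagreement_le_violated_edges:
  assumes "finite I"
  shows "\<exists>g. mono g \<and> disagreement I f g \<le> card (violated_edges I f)"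
  using assms
proof (induction I arbitrary: f rule: finite_induct)
  case empty
  have "mono (\<lambda>_. f {})" by (simp add: mono_def)
  moreover have "disagreement {} f (\<lambda>_. f {}) = 0" by (simp add: disagreement_def)
  ultimately show ?case by (metis le0)
next
  case (insert j I)
  let ?f1 = "\<lambda>X. f (insert j X)"
  let ?A = "{X \<in> Pow I. f X \<and> \<not> ?f1 X}"
  obtain a0 where a0: "mono a0" "disagreement I f a0 \<le> card (violated_edges I f)"
    using insert.IH by blast
  obtain a1 where a1: "mono a1" "disagreement I ?f1 a1 \<le> card (violated_edges I ?f1)"
    using insert.IH by blast
  let ?join = "\<lambda>X. a0 X \<or> a1 X" and ?meet = "\<lambda>X. a0 X \<and> a1 X"
  have glue: "\<exists>g. mono g \<and>
      disagreement (insert j I) f g = disagreement I f g0 + disagreement I ?f1 g1"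
    if "mono g0" "mono g1" and le: "\<And>X. g0 X \<Longrightarrow> g1 X" for g0 g1
  proof (intro exI conjI)
    \<comment> \<open>Both facets are indexed by the subsets of \<open>I\<close>, hence
      \<open>j\<close> is removed before \<open>g1\<close> is applied.\<close>
    let ?g = "\<lambda>X. if j \<in> X then g1 (X - {j}) else g0 X"
    show "mono ?g"
    proof (rule monoI, rule le_boolI)
      fix X Y :: "'a set" assume XY: "X \<subseteq> Y" and gX: "?g X"
      have 1: "g1 (X - {j}) \<Longrightarrow> g1 (Y - {j})"
        using monoD[OF that(2), of "X - {j}" "Y - {j}"] XY by auto
      have 2: "j \<notin> X \<Longrightarrow> g0 X \<Longrightarrow> g0 (Y - {j})"
        using monoD[OF that(1), of X "Y - {j}"] XY by auto
      \<comment> \<open>Only when \<open>j\<close> lies in \<open>Y\<close> but not in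
        \<open>X\<close> does the comparison cross facets; there \<open>le\<close> carries
        \<open>g0\<close> over to \<open>g1\<close>.\<close>
      show "?g Y" using 1 2 gX XY le by (cases "j \<in> X"; cases "j \<in> Y") auto
    qed
    have "disagreement I f ?g = disagreement I f g0"
      by (rule disagreement_cong) (use insert.hyps(2) in auto)
    moreover have "disagreement I ?f1 (\<lambda>X. ?g (insert j X)) = disagreement I ?f1 g1"
    proof (rule disagreement_cong)
      fix X assume "X \<subseteq> I"
      then have "insert j X - {j} = X" using insert.hyps(2) by blast
      then show "?g (insert j X) = g1 X" by simp
    qed
    ultimately show "disagreement (insert j I) f ?g =
        disagreement I f g0 + disagreement I ?f1 g1"
      using disagreement_insert[OF insert.hyps, of f ?g] by simp
  qed
  have "mono ?join" "mono ?meet"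
    using a0(1) a1(1) unfolding mono_def le_bool_def by blast+
  then obtain g h where
    g: "mono g" "disagreement (insert j I) f g = disagreement I f a0 + disagreement I ?f1 ?join" and
    h: "mono h" "disagreement (insert j I) f h = disagreement I f ?meet + disagreement I ?f1 a1"
    using glue[of a0 ?join] glue[of ?meet a1] a0(1) a1(1) by blast
  have "card ?A = (\<Sum>X\<in>Pow I. of_bool (f X \<and> \<not> ?f1 X))"
    using insert.hyps(1) by (simp add: sum_of_bool_eq Int_def)
  \<comment> \<open>Where \<open>a0 \<le> a1\<close> fails, the two repairs assign \<open>(1,1)\<close> and \<open>(0,0)\<close>, so together they make
    exactly two errors there.\<close>
  then have "disagreement (insert j I) f g + disagreement (insert j I) f h
      \<le> 2 * disagreement I f a0 + 2 * disagreement I ?f1 a1 + 2 * card ?A"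
    unfolding g(2) h(2) unfolding disagreement_def
    by (simp only: sum_distrib_left sum.distrib[symmetric]) (rule sum_mono, auto simp: of_bool_def)
  \<comment> \<open>The two costs add up to at most twice the bound, so the cheaper repair meets
    it.\<close>
  then have "disagreement (insert j I) f g \<le> card (violated_edges (insert j I) f)
      \<or> disagreement (insert j I) f h \<le> card (violated_edges (insert j I) f)"
    using card_violated_edges_insert[OF insert.hyps, of f] a0(2) a1(2) by linarith
  then show ?case using g(1) h(1) by blast
qed

section \<open>Edge-disjoint paths from cuts\<close>

text \<open>One format for the hypercube, its residual graphs and the edge sets carrying a flow, so
  that the theory of walks applies to all of them.\<close>

definition rel_digraph :: "'a set \<Rightarrow> ('a \<times> 'a) set \<Rightarrow> ('a, 'a \<times> 'a) pre_digraph" where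
  "rel_digraph V E = \<lparr>verts = V, arcs = E, tail = fst, head = snd\<rparr>"

lemma rel_digraph_simps [simp]:
  "verts (rel_digraph V E) = V" "arcs (rel_digraph V E) = E"
  "tail (rel_digraph V E) = fst" "head (rel_digraph V E) = snd"
  by (simp_all add: rel_digraph_def)

lemma arcs_ends_rel_digraph [simp]: "arcs_ends (rel_digraph V E) = E"
  by (force simp: arcs_ends_def arc_to_ends_def)

lemma wf_rel_digraph: "E \<subseteq> V \<times> V \<Longrightarrow> wf_digraph (rel_digraph V E)"
  by unfold_locales auto

lemma apath_rel_digraph_mono:
  assumes "F \<subseteq> E" "E \<subseteq> V \<times> V" "pre_digraph.apath (rel_digraph V F) u p v"
  shows "pre_digraph.apath (rel_digraph V E) u p v"
proof (rule wf_digraph.subgraph_apath_imp_apath[OF wf_rel_digraph[OF assms(2)] assms(3)])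
  show "subgraph (rel_digraph V F) (rel_digraph V E)"
    using assms(1,2) by (intro subgraphI) (auto simp: compatible_def intro: wf_rel_digraph)
qed

text \<open>An edge set \<open>F\<close> is read as a flow with values 0 and 1, which makes
  integrality automatic; this is its divergence at \<open>v\<close>.\<close>

definition net_outflow :: "('a \<times> 'a) set \<Rightarrow> 'a \<Rightarrow> int" where
  "net_outflow F v = (\<Sum>e\<in>F. of_bool (fst e = v) - of_bool (snd e = v))"

lemma net_outflow_Un:
  "finite F \<Longrightarrow> finite G \<Longrightarrow> F \<inter> G = {} \<Longrightarrow> net_outflow (F \<union> G) v = net_outflow F v + net_outflow G v"
  unfolding net_outflow_def by (rule sum.union_disjoint)

lemma net_outflow_Diff:
  "finite F \<Longrightarrow> G \<subseteq> F \<Longrightarrow> net_outflow (F - G) v = net_outflow F v - net_outflow G v"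
  unfolding net_outflow_def by (rule sum_diff)

lemma net_outflow_converse: "net_outflow (F\<inverse>) v = - net_outflow F v"
proof -
  have "F\<inverse> = prod.swap ` F" by auto
  then have "net_outflow (F\<inverse>) v = (\<Sum>e\<in>F. of_bool (snd e = v) - of_bool (fst e = v))"
    unfolding net_outflow_def by (simp add: sum.reindex)
  then show ?thesis by (simp add: net_outflow_def sum_negf[symmetric])
qed

text \<open>Edges with both ends in \<open>U\<close> cancel, leaving the edges out of
  \<open>U\<close> minus the edges into \<open>U\<close>.\<close>

lemma sum_net_outflow:
  assumes "finite U"
  shows "(\<Sum>v\<in>U. net_outflow F v) = (\<Sum>e\<in>F. of_bool (fst e \<in> U) - of_bool (snd e \<in> U))"
proof -
  have "(\<Sum>v\<in>U. of_bool (x = v)) = (of_bool (x \<in> U) :: int)" for x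
    using assms by (simp add: of_bool_def sum.delta')
  then show ?thesis
    unfolding net_outflow_def by (subst sum.swap) (simp add: sum_subtractf)
qed

lemma net_outflow_apath:
  assumes "E \<subseteq> V \<times> V" "pre_digraph.apath (rel_digraph V E) u p v"
  shows "net_outflow (set p) x = of_bool (u = x) - of_bool (v = x)"
  using assms(2)
proof (induction p arbitrary: u)
  interpret wf_digraph "rel_digraph V E" by (rule wf_rel_digraph[OF assms(1)])
  case Nil
  then show ?case by (simp add: apath_Nil_iff net_outflow_def)
next
  interpret wf_digraph "rel_digraph V E" by (rule wf_rel_digraph[OF assms(1)])
  case (Cons e p)
  then have e: "fst e = u" "apath (snd e) p v" "fst e \<notin> set (awalk_verts (snd e) p)"
    unfolding apath_Cons_iff rel_digraph_simps by blast+
  \<comment> \<open>A simple path never returns to its first vertex, so \<open>e\<close> does not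
    recur and \<open>set\<close> loses no multiplicity.\<close>
  then have "e \<notin> set p" by (auto simp: awalk_verts_conv split: if_splits)
  then have "net_outflow (set (e # p)) x
      = of_bool (fst e = x) - of_bool (snd e = x) + net_outflow (set p) x"
    by (simp add: net_outflow_def)
  with Cons.IH[OF e(2)] e(1) show ?case by simp
qed

text \<open>The set of vertices reachable from \<open>S\<close> either meets \<open>T\<close> or is
  the closed set \<open>U\<close>. On a residual graph this yields an augmenting path or a tight
  cut; on a flow it yields a path to split off.\<close>

lemma apath_or_closed_set:
  assumes "E \<subseteq> V \<times> V" "S \<subseteq> V"
  obtains s p t where "s \<in> S" "t \<in> T" "pre_digraph.apath (rel_digraph V E) s p t"
  | U where "S \<subseteq> U" "U \<subseteq> V" "U \<inter> T = {}" "\<And>x y. (x, y) \<in> E \<Longrightarrow> x \<in> U \<Longrightarrow> y \<in> U"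
proof -
  interpret wf_digraph "rel_digraph V E" by (rule wf_rel_digraph[OF assms(1)])
  let ?U = "{v. \<exists>s\<in>S. s \<rightarrow>\<^sup>*\<^bsub>rel_digraph V E\<^esub> v}"
  show ?thesis
  proof (cases "?U \<inter> T = {}")
    case True
    show ?thesis
    proof (rule that(2)[of ?U])
      show "S \<subseteq> ?U"
      proof
        fix s assume "s \<in> S"
        then have "s \<rightarrow>\<^sup>*\<^bsub>rel_digraph V E\<^esub> s" using assms(2) by (intro reachable_refl) auto
        then show "s \<in> ?U" using \<open>s \<in> S\<close> by blast
      qed
      show "?U \<subseteq> V" using reachable_in_verts(2) by fastforce
      show "y \<in> ?U" if "(x, y) \<in> E" "x \<in> ?U" for x y
        using that reachable_adj_trans[of _ x y] by auto
    qed (fact True)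
  next
    case False
    then show ?thesis using that(1) unfolding reachable_apath by blast
  qed
qed

text \<open>Forward arcs of \<open>P\<close> are added to \<open>F\<close>, and backward arcs cancel
  the edges they reverse. Cancelling an edge has the same effect on the divergence as adding its
  reversal.\<close>

lemma residual_augment:
  assumes "finite E" "asym E" "F \<subseteq> E" "P \<subseteq> (E - F) \<union> F\<inverse>"
  obtains F' where "F' \<subseteq> E" "\<And>v. net_outflow F' v = net_outflow F v + net_outflow P v"
proof -
  let ?P1 = "P \<inter> (E - F)" and ?P2 = "P \<inter> F\<inverse>"
  let ?F' = "(F - ?P2\<inverse>) \<union> ?P1"
  have fin: "finite F" "finite P" "finite ?P1" "finite ?P2"
    using assms by (auto intro: finite_subset)
  \<comment> \<open>As \<open>E\<close> has no antiparallel edges, no arc is both forward and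
    backward.\<close>
  have "?P1 \<inter> ?P2 = {}" using assms(2,3) by (auto dest: asymD)
  moreover have "P = ?P1 \<union> ?P2" using assms(4) by blast
  ultimately have P: "net_outflow P v = net_outflow ?P1 v + net_outflow ?P2 v" for v
    using net_outflow_Un[OF fin(3,4)] by metis
  have "net_outflow ?F' v = net_outflow F v + net_outflow P v" for v
  proof -
    have "net_outflow ?F' v = net_outflow (F - ?P2\<inverse>) v + net_outflow ?P1 v"
      using fin by (intro net_outflow_Un) auto
    also have "net_outflow (F - ?P2\<inverse>) v = net_outflow F v - net_outflow (?P2\<inverse>) v"
      using fin(1) by (intro net_outflow_Diff) auto
    finally show ?thesis unfolding P net_outflow_converse by simp
  qed
  moreover have "?F' \<subseteq> E" using assms(3) by blast
  ultimately show ?thesis using that by blast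
qed

text \<open>Ford-Fulkerson: each residual path from \<open>S\<close> to \<open>T\<close> raises the
  value by one. If none exists at value \<open>k\<close>, the residually reachable set has a cut of
  only \<open>k\<close> edges, against the cut bound \<open>Suc k\<close>.\<close>

lemma max_flow_ge_min_cut:
  assumes V: "finite V" "E \<subseteq> V \<times> V" and "asym E" and ST: "S \<subseteq> V" "T \<subseteq> V" "S \<inter> T = {}"
    and cut: "\<And>U. S \<subseteq> U \<Longrightarrow> U \<subseteq> V \<Longrightarrow> U \<inter> T = {} \<Longrightarrow> k \<le> card {e \<in> E. fst e \<in> U \<and> snd e \<notin> U}"
  shows "\<exists>F\<subseteq>E. (\<forall>v\<in>V - (S \<union> T). net_outflow F v = 0) \<and> (\<Sum>v\<in>S. net_outflow F v) = int k"
  using cut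
proof (induction k)
  case 0
  then show ?case by (intro exI[of _ "{}"]) (simp add: net_outflow_def)
next
  case (Suc k)
  have finE: "finite E" using V finite_subset by blast
  obtain F where F: "F \<subseteq> E" "\<forall>v\<in>V - (S \<union> T). net_outflow F v = 0"
      "(\<Sum>v\<in>S. net_outflow F v) = int k"
    using Suc by (meson Suc_leD)
  let ?R = "(E - F) \<union> F\<inverse>"
  have R: "?R \<subseteq> V \<times> V" using F(1) V(2) by auto
  show ?case
  proof (rule apath_or_closed_set[OF R ST(1), of T])
    fix s p t assume st: "s \<in> S" "t \<in> T" and p: "pre_digraph.apath (rel_digraph V ?R) s p t"
    have "set p \<subseteq> ?R" using p by (simp add: pre_digraph.apath_def pre_digraph.awalk_def)
    then obtain F' where F': "F' \<subseteq> E"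
        "\<And>v. net_outflow F' v = net_outflow F v + net_outflow (set p) v"
      using residual_augment[OF finE \<open>asym E\<close> F(1)] by blast
    have b: "net_outflow F' v = net_outflow F v + of_bool (s = v) - of_bool (t = v)" for v
      using F'(2)[of v] net_outflow_apath[OF R p, of v] by simp
    have "finite S" using V(1) ST(1) finite_subset by blast
    moreover have "t \<notin> S" using st(2) ST(3) by blast
    ultimately have "(\<Sum>v\<in>S. net_outflow F' v) = int (Suc k)"
      using st(1) F(3) by (simp add: b sum.distrib sum_subtractf of_bool_def sum.delta')
    moreover have "\<forall>v\<in>V - (S \<union> T). net_outflow F' v = 0"
      using F(2) st by (auto simp: b)
    ultimately show ?thesis using F'(1) by blast
  next
    fix U assume U: "S \<subseteq> U" "U \<subseteq> V" "U \<inter> T = {}" "\<And>x y. (x, y) \<in> ?R \<Longrightarrow> x \<in> U \<Longrightarrow> y \<in> U"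
    have finU: "finite U" using U(2) V(1) finite_subset by blast
    \<comment> \<open>Since \<open>U\<close> avoids \<open>T\<close>, the flow is conserved on all
      of \<open>U\<close> outside \<open>S\<close>.\<close>
    have "int k = (\<Sum>v\<in>U. net_outflow F v)"
      unfolding F(3)[symmetric] using U F(2) finU by (intro sum.mono_neutral_left) auto
    also have "\<dots> = (\<Sum>e\<in>F. of_bool (fst e \<in> U) - of_bool (snd e \<in> U))"
      by (rule sum_net_outflow[OF finU])
    \<comment> \<open>No edge of \<open>F\<close> enters \<open>U\<close>, as its reversal would be
      a residual arc leaving \<open>U\<close>.\<close>
    also have "\<dots> = (\<Sum>e\<in>F. of_bool (fst e \<in> U \<and> snd e \<notin> U))"
    proof (intro sum.cong refl)
      fix e assume "e \<in> F"
      then have "fst e \<in> U" if "snd e \<in> U" using that U(4)[of "snd e" "fst e"] by auto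
      then show "of_bool (fst e \<in> U) - of_bool (snd e \<in> U) =
          (of_bool (fst e \<in> U \<and> snd e \<notin> U) :: int)" by auto
    qed
    also have "\<dots> = int (card {e \<in> F. fst e \<in> U \<and> snd e \<notin> U})"
      using finite_subset[OF F(1) finE] by (simp add: sum_of_bool_eq Int_def)
    \<comment> \<open>All edges of \<open>E\<close> leaving \<open>U\<close> are saturated: one
      outside \<open>F\<close> would be a residual arc.\<close>
    also have "{e \<in> F. fst e \<in> U \<and> snd e \<notin> U} = {e \<in> E. fst e \<in> U \<and> snd e \<notin> U}"
      using U(4)[of "fst e" "snd e" for e] F(1) by fastforce
    finally show ?thesis using Suc.prems[OF U(1-3)] by linarith
  qed
qed

text \<open>Deleting the edges of a path from \<open>S\<close> to \<open>T\<close> lowers the value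
  by one and keeps conservation, and later paths use only the remaining edges. Cycles of
  \<open>F\<close> may be left over.\<close>

lemma flow_decomposition:
  assumes V: "finite V" "F \<subseteq> V \<times> V" and ST: "S \<subseteq> V" "T \<subseteq> V" "S \<inter> T = {}"
    and "\<forall>v\<in>V - (S \<union> T). net_outflow F v = 0" "(\<Sum>v\<in>S. net_outflow F v) = int k"
  shows "\<exists>P. finite P \<and> card P = k
    \<and> (\<forall>p\<in>P. \<exists>s\<in>S. \<exists>t\<in>T. pre_digraph.apath (rel_digraph V F) s p t)
    \<and> (\<forall>p\<in>P. \<forall>q\<in>P. p \<noteq> q \<longrightarrow> set p \<inter> set q = {})"
  using assms(2,6,7)
proof (induction k arbitrary: F)
  case 0
  then show ?case by (intro exI[of _ "{}"]) simp
next
  case (Suc k)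
  have finF: "finite F" using Suc.prems(1) V(1) finite_subset by blast
  show ?case
  proof (rule apath_or_closed_set[OF Suc.prems(1) ST(1), of T])
    fix s p t assume st: "s \<in> S" "t \<in> T" and p: "pre_digraph.apath (rel_digraph V F) s p t"
    let ?F = "F - set p"
    have pF: "set p \<subseteq> F" using p by (simp add: pre_digraph.apath_def pre_digraph.awalk_def)
    have b: "net_outflow ?F v = net_outflow F v - of_bool (s = v) + of_bool (t = v)" for v
      using net_outflow_Diff[OF finF pF] net_outflow_apath[OF Suc.prems(1) p] by simp
    have "finite S" using V(1) ST(1) finite_subset by blast
    moreover have "t \<notin> S" using st(2) ST(3) by blast
    ultimately have "(\<Sum>v\<in>S. net_outflow ?F v) = int k"
      using st(1) Suc.prems(3) by (simp add: b sum.distrib sum_subtractf of_bool_def sum.delta')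
    moreover have "\<forall>v\<in>V - (S \<union> T). net_outflow ?F v = 0"
      using Suc.prems(2) st by (auto simp: b)
    moreover have "?F \<subseteq> V \<times> V" using Suc.prems(1) by blast
    ultimately obtain P where P: "finite P" "card P = k"
        "\<And>q. q \<in> P \<Longrightarrow> \<exists>s\<in>S. \<exists>t\<in>T. pre_digraph.apath (rel_digraph V ?F) s q t"
        "\<And>q r. q \<in> P \<Longrightarrow> r \<in> P \<Longrightarrow> q \<noteq> r \<Longrightarrow> set q \<inter> set r = {}"
      using Suc.IH[of ?F] by metis
    have disj: "set q \<inter> set p = {}" if "q \<in> P" for q
      using P(3)[OF that] by (auto simp: pre_digraph.apath_def pre_digraph.awalk_def)
    \<comment> \<open>An empty path would be disjoint from itself and might already lie in
      \<open>P\<close>, which would spoil the count.\<close>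
    have "s \<noteq> t" using st ST(3) by blast
    then have "p \<noteq> []" using p by (auto simp: pre_digraph.apath_def pre_digraph.awalk_def pre_digraph.cas.simps)
    then have "p \<notin> P" using disj[of p] by auto
    show ?thesis
    proof (intro exI[of _ "insert p P"] conjI ballI impI)
      show "card (insert p P) = Suc k" using P(1,2) \<open>p \<notin> P\<close> by simp
      show "\<exists>s\<in>S. \<exists>t\<in>T. pre_digraph.apath (rel_digraph V F) s q t" if "q \<in> insert p P" for q
        using that p st P(3) apath_rel_digraph_mono[of ?F F V] Suc.prems(1) by blast
      show "set q \<inter> set r = {}" if "q \<in> insert p P" "r \<in> insert p P" "q \<noteq> r" for q r
        using that disj[of q] disj[of r] P(4)[of q r] by blast
    qed (use P(1) in simp)
  next
    fix U assume U: "S \<subseteq> U" "U \<subseteq> V" "U \<inter> T = {}" "\<And>x y. (x, y) \<in> F \<Longrightarrow> x \<in> U \<Longrightarrow> y \<in> U"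
    have finU: "finite U" using U(2) V(1) finite_subset by blast
    have "int (Suc k) = (\<Sum>v\<in>U. net_outflow F v)"
      unfolding Suc.prems(3)[symmetric] using U Suc.prems(2) finU
      by (intro sum.mono_neutral_left) auto
    also have "\<dots> = (\<Sum>e\<in>F. of_bool (fst e \<in> U) - of_bool (snd e \<in> U))"
      by (rule sum_net_outflow[OF finU])
    \<comment> \<open>No edge of \<open>F\<close> leaves the closed set \<open>U\<close>, so its net
      outflow cannot be positive.\<close>
    also have "\<dots> \<le> 0" using U(4) by (intro sum_nonpos) auto
    finally show ?thesis by simp
  qed
qed

theorem edge_disjoint_paths_of_cuts:
  assumes "finite V" "E \<subseteq> V \<times> V" "asym E" "S \<subseteq> V" "T \<subseteq> V" "S \<inter> T = {}"
    and "\<And>U. S \<subseteq> U \<Longrightarrow> U \<subseteq> V \<Longrightarrow> U \<inter> T = {} \<Longrightarrow> k \<le> card {e \<in> E. fst e \<in> U \<and> snd e \<notin> U}"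
  shows "\<exists>P. finite P \<and> card P = k
    \<and> (\<forall>p\<in>P. \<exists>s\<in>S. \<exists>t\<in>T. pre_digraph.apath (rel_digraph V E) s p t)
    \<and> (\<forall>p\<in>P. \<forall>q\<in>P. p \<noteq> q \<longrightarrow> set p \<inter> set q = {})"
proof -
  obtain F where F: "F \<subseteq> E" "\<forall>v\<in>V - (S \<union> T). net_outflow F v = 0"
      "(\<Sum>v\<in>S. net_outflow F v) = int k"
    using max_flow_ge_min_cut[OF assms] by blast
  obtain P where P: "finite P" "card P = k"
      "\<forall>p\<in>P. \<exists>s\<in>S. \<exists>t\<in>T. pre_digraph.apath (rel_digraph V F) s p t"
      "\<forall>p\<in>P. \<forall>q\<in>P. p \<noteq> q \<longrightarrow> set p \<inter> set q = {}"
    using flow_decomposition[OF assms(1) subset_trans[OF F(1) assms(2)] assms(4-6) F(2,3)] by blast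
  have "\<forall>p\<in>P. \<exists>s\<in>S. \<exists>t\<in>T. pre_digraph.apath (rel_digraph V E) s p t"
    using P(3) apath_rel_digraph_mono[OF F(1) assms(2)] by meson
  with P(1,2,4) show ?thesis by blast
qed

section \<open>The directed hypercube\<close>

text \<open>Indicator vectors identify the subset lattice, where monotone approximation was proved,
  with the cube; the restriction makes them extensional, as \<open>cube\<close> demands.\<close>

definition cube_point :: "nat \<Rightarrow> nat set \<Rightarrow> nat \<Rightarrow> nat" where
  "cube_point d X = (\<lambda>i\<in>{..<d}. of_bool (i \<in> X))"

definition cube_support :: "nat \<Rightarrow> (nat \<Rightarrow> nat) \<Rightarrow> nat set" where
  "cube_support d x = {i. i < d \<and> x i = 1}"

lemma cube_point_in_cube: "cube_point d X \<in> cube d"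
  by (auto simp: cube_point_def cube_def)

lemma cube_support_subset: "cube_support d x \<subseteq> {..<d}"
  by (auto simp: cube_support_def)

lemma cube_support_point: "X \<subseteq> {..<d} \<Longrightarrow> cube_support d (cube_point d X) = X"
  by (auto simp: cube_support_def cube_point_def)

lemma cube_point_support:
  assumes "x \<in> cube d"
  shows "cube_point d (cube_support d x) = x"
proof
  fix i
  show "cube_point d (cube_support d x) i = x i"
    using assms by (cases "i < d") (auto simp: cube_point_def cube_support_def cube_def PiE_def
        Pi_def extensional_def)
qed

lemma cube_support_mono:
  assumes "y \<in> cube d" "cube_less d x y"
  shows "cube_support d x \<subseteq> cube_support d y"
proof
  fix i assume "i \<in> cube_support d x"
  then have "i < d" "1 \<le> y i"
    using assms(2) by (auto simp: cube_support_def cube_less_def)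
  moreover have "y i \<in> {0, 1}" using assms(1) \<open>i < d\<close> by (auto simp: cube_def)
  ultimately show "i \<in> cube_support d y" by (auto simp: cube_support_def)
qed

lemma cube_edge_insert:
  assumes "X \<subseteq> {..<d}" "i < d" "i \<notin> X"
  shows "(cube_point d X, cube_point d (insert i X)) \<in> cube_edges d"
proof -
  have "{j. j < d \<and> cube_point d X j \<noteq> cube_point d (insert i X) j} = {i}"
    using assms by (auto simp: cube_point_def)
  moreover have "{j. j < d \<and> cube_point d X j = 1} = X"
    using cube_support_point[OF assms(1)] by (simp add: cube_support_def)
  moreover have "{j. j < d \<and> cube_point d (insert i X) j = 1} = insert i X"
    using cube_support_point[of "insert i X" d] assms by (simp add: cube_support_def)
  moreover have "finite X" using assms(1) finite_subset by blast
  ultimately show ?thesis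
    using assms(3) by (simp add: cube_edges_def cube_point_in_cube)
qed

lemma finite_cube: "finite (cube d)"
  by (simp add: cube_def finite_PiE)

lemma cube_edges_subset: "cube_edges d \<subseteq> cube d \<times> cube d"
  by (auto simp: cube_edges_def)

text \<open>Each edge raises the number of ones, so its reversal is not an edge.\<close>

lemma asym_cube_edges: "asym (cube_edges d)"
  by (auto simp: cube_edges_def intro!: asymI)

lemma matched_pair_cut:
  assumes m: "matched_pair d S T \<phi>" and "S \<subseteq> U" "U \<inter> T = {}"
  shows "card S \<le> card {e \<in> cube_edges d. fst e \<in> U \<and> snd e \<notin> U}"
proof -
  let ?I = "{..<d}" and ?f = "\<lambda>X. cube_point d X \<in> U"
  have ST: "S \<subseteq> cube d" "T \<subseteq> cube d" "bij_betw \<phi> S T" "\<And>s. s \<in> S \<Longrightarrow> cube_less d s (\<phi> s)"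
    using m by (auto simp: matched_pair_def)
  have \<phi>T: "\<phi> s \<in> T" if "s \<in> S" for s using that ST(3) by (auto simp: bij_betw_def)
  obtain g where g: "mono g" "disagreement ?I ?f g \<le> card (violated_edges ?I ?f)"
    using monotone_disagreement_le_violated_edges[of ?I ?f] by auto
  \<comment> \<open>A monotone \<open>g\<close> disagrees with the indicator of \<open>U\<close> at \<open>s\<close> or at \<open>\<phi> s\<close>.\<close>
  define \<psi> where "\<psi> s = (if g (cube_support d s) then \<phi> s else s)" for s
  have \<psi>: "\<psi> s \<in> cube d" if "s \<in> S" for s using that ST(1,2) \<phi>T by (auto simp: \<psi>_def)
  \<comment> \<open>\<open>S\<close> lies inside \<open>U\<close> and \<open>T\<close> outside, so
    values of the two kinds never collide; within each kind, \<open>\<phi>\<close> or the identity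
    is injective.\<close>
  have "inj_on \<psi> S"
    using ST(3) \<phi>T assms(2,3) by (auto simp: inj_on_def \<psi>_def bij_betw_def)
  then have "inj_on (\<lambda>s. cube_support d (\<psi> s)) S"
    unfolding inj_on_def using \<psi> cube_point_support by metis
  moreover have "cube_support d (\<psi> s) \<in> {X \<in> Pow ?I. ?f X \<noteq> g X}" if "s \<in> S" for s
  proof (cases "g (cube_support d s)")
    case True
    \<comment> \<open>Monotonicity keeps \<open>g\<close> true at \<open>\<phi> s\<close>, which
      lies outside \<open>U\<close>. In the other case \<open>g\<close> is already false at
      \<open>s\<close>, inside \<open>U\<close>.\<close>
    then have "g (cube_support d (\<phi> s))"
      using monoD[OF g(1) cube_support_mono[OF _ ST(4)[OF that]]] \<phi>T[OF that] ST(2) by auto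
    then show ?thesis
      using True \<phi>T[OF that] assms(3) cube_support_subset[of d "\<phi> s"]
        cube_point_support[OF subsetD[OF ST(2) \<phi>T[OF that]]] by (auto simp: \<psi>_def)
  next
    case False
    then show ?thesis
      using that assms(2) cube_support_subset[of d s] cube_point_support[OF subsetD[OF ST(1) that]]
      by (auto simp: \<psi>_def)
  qed
  ultimately have "card S \<le> card {X \<in> Pow ?I. ?f X \<noteq> g X}"
    by (intro card_inj_on_le) auto
  also have "\<dots> = disagreement ?I ?f g"
    by (simp add: disagreement_def sum_of_bool_eq Int_def)
  also note g(2)
  also have "card (violated_edges ?I ?f) \<le> card {e \<in> cube_edges d. fst e \<in> U \<and> snd e \<notin> U}"
  proof (rule card_inj_on_le[where f = "\<lambda>(X, i). (cube_point d X, cube_point d (insert i X))"])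
    show "inj_on (\<lambda>(X, i). (cube_point d X, cube_point d (insert i X))) (violated_edges ?I ?f)"
    proof (rule inj_onI, clarify)
      fix X i Y j assume v: "(X, i) \<in> violated_edges ?I ?f" "(Y, j) \<in> violated_edges ?I ?f"
        and eq: "cube_point d X = cube_point d Y"
          "cube_point d (insert i X) = cube_point d (insert j Y)"
      have sub: "X \<subseteq> ?I" "Y \<subseteq> ?I" "insert i X \<subseteq> ?I" "insert j Y \<subseteq> ?I"
        and ij: "i \<notin> X" "j \<notin> Y"
        using v by (auto simp: violated_edges_def)
      have "X = Y" "insert i X = insert j Y"
        using sub eq cube_support_point by metis+
      then show "X = Y \<and> i = j" using ij by auto
    qed
    show "finite {e \<in> cube_edges d. fst e \<in> U \<and> snd e \<notin> U}"
      using finite_subset[OF cube_edges_subset] finite_cube by auto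
  qed (auto simp: violated_edges_def intro: cube_edge_insert)
  finally show ?thesis .
qed

theorem theorem4p12:
  fixes d :: nat
    and S T :: "(nat \<Rightarrow> nat) set"
    and \<phi> :: "(nat \<Rightarrow> nat) \<Rightarrow> (nat \<Rightarrow> nat)"
  assumes "d \<ge> 1"
    and "matched_pair d S T \<phi>"
    and "S \<inter> T = {}"
  shows "\<exists>P. finite P \<and> card P = card S
    \<and> (\<forall>p\<in>P. \<exists>s\<in>S. \<exists>t\<in>T. pre_digraph.apath (directed_hypercube d) s p t)
    \<and> (\<forall>p\<in>P. \<forall>q\<in>P. p \<noteq> q \<longrightarrow> set p \<inter> set q = {})"
proof -
  have "directed_hypercube d = rel_digraph (cube d) (cube_edges d)"
    by (simp add: directed_hypercube_def rel_digraph_def)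
  moreover have "S \<subseteq> cube d" "T \<subseteq> cube d" using assms(2) by (auto simp: matched_pair_def)
  ultimately show ?thesis
    using edge_disjoint_paths_of_cuts[OF finite_cube cube_edges_subset asym_cube_edges _ _ assms(3)]
      matched_pair_cut[OF assms(2)] by simp
qed

end
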